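(* Let $f\in\mathcal{C}^\infty_c(\mathbb{R}^d_+)$. The full Radon transform $\mathcal{R}(f)(\omega,s)$ on the entire domain $(\omega,s)\in\mathbb{S}^{d-1}\times\mathbb{R}$ can be recovered from the incomplete initial data restricted to $\mathbb{S}^{d-1}_+\times(0,\infty)$.
   Context: $\mathbb{R}^d_+=(0,\infty)^d$; $\mathcal{C}^\infty_c(\mathbb{R}^d_+)$ is the space of compactly supported smooth functions on $\mathbb{R}^d_+$ (viewed as functions on $\mathbb{R}^d$, extended by zero); $\mathbb{S}^{d-1}$ is the unit sphere of $\mathbb{R}^d$ and $\mathbb{S}^{d-1}_+=\mathbb{S}^{d-1}\cap\mathbb{R}^d_+$. The Radon transform of an integrable function $g$ on $\mathbb{R}^d$ is $\mathcal{R}(g)(\omega,s)=\int_{H(\omega,s)}g(t)\,d\sigma_H(t)$ for $\omega\in\mathbb{S}^{d-1}$ and a.e. $s\in\mathbb{R}$, where $H(\omega,s)=\{t\in\mathbb{R}^d:\omega\cdot t=s\}$ and $\sigma_H$ is the surface area measure of $H(\omega,s)$. The incomplete initial data are the values of $\mathcal{R}(f)$ on $\mathbb{S}^{d-1}_+\times(0,\infty)$. *)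

theory Defs
  imports "HOL-Analysis.Analysis" "HOL-Library.FuncSet"
begin

definition pos_orthant :: "(real ^ 'n) set" where
  "pos_orthant = {x. \<forall>i. 0 < x $ i}"

definition pos_sphere :: "(real ^ 'n) set" where
  "pos_sphere = sphere 0 1 \<inter> pos_orthant"

(* On an open set S all iterated directional derivatives up to order k exist (in the Frechet
   sense) and are continuous, i.e. f is of class C^k on S. *)
primrec cont_diff_on ::
  "nat \<Rightarrow> 'a::real_normed_vector set \<Rightarrow> ('a \<Rightarrow> 'b::real_normed_vector) \<Rightarrow> bool"
where
  "cont_diff_on 0 S f \<longleftrightarrow> continuous_on S f"
| "cont_diff_on (Suc k) S f \<longleftrightarrow>
     (\<forall>x\<in>S. f differentiable (at x)) \<and>
     (\<forall>v. cont_diff_on k S (\<lambda>x. frechet_derivative f (at x) v))"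

definition smooth_on :: "'a::real_normed_vector set \<Rightarrow> ('a \<Rightarrow> 'b::real_normed_vector) \<Rightarrow> bool" where
  "smooth_on S f \<longleftrightarrow> (\<forall>k. cont_diff_on k S f)"

(* Functions on the whole space, zero off the orthant; the support (closure taken in the whole
   space) is a compact subset of the open orthant.  Values are complex; the real-valued test
   functions are among them. *)
definition test_functions :: "(real ^ 'n \<Rightarrow> complex) set" where
  "test_functions =
     {f. smooth_on pos_orthant f \<and> compact (closure {x. f x \<noteq> 0}) \<and>
         closure {x. f x \<noteq> 0} \<subseteq> pos_orthant}"

definition hyperplane :: "real ^ 'n \<Rightarrow> real \<Rightarrow> (real ^ 'n) set" where
  "hyperplane \<omega> s = {t. \<omega> \<bullet> t = s}"

definition orthonormal_basis_of :: "'a::euclidean_space set \<Rightarrow> 'a set \<Rightarrow> bool" where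
  "orthonormal_basis_of V B \<longleftrightarrow> pairwise orthogonal B \<and> (\<forall>b\<in>B. norm b = 1) \<and> span B = V"

lemma orthonormal_basis_of_ex: "subspace V \<Longrightarrow> \<exists>B. orthonormal_basis_of V B"
  by (rule orthonormal_basis_subspace[of V]) (auto simp: orthonormal_basis_of_def)

lemma orthonormal_basis_of_finite: "orthonormal_basis_of V B \<Longrightarrow> finite B"
  by (simp add: orthonormal_basis_of_def pairwise_orthogonal_imp_finite)

definition hyperplane_basis :: "real ^ 'n \<Rightarrow> (real ^ 'n) set" where
  "hyperplane_basis \<omega> = (SOME B. orthonormal_basis_of (hyperplane \<omega> 0) B)"

lemma hyperplane_basis: "orthonormal_basis_of (hyperplane \<omega> 0) (hyperplane_basis \<omega>)"
proof -
  have "subspace (hyperplane \<omega> 0)"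
    unfolding hyperplane_def by (rule subspace_hyperplane)
  then show ?thesis
    unfolding hyperplane_basis_def by (rule someI_ex[OF orthonormal_basis_of_ex])
qed

(* For a unit vector \<omega>, the (d-1)-dimensional surface area measure of the hyperplane, as a Borel
   measure on the whole space: the image of (d-1)-dimensional Lebesgue measure under the isometric
   parametrisation u |-> s \<omega> + sum_b u_b b, with b ranging over an orthonormal basis of the
   orthogonal complement of \<omega>.  This is how lborel itself is built from Basis.  By rotation
   invariance of Lebesgue measure the choice of the basis does not matter.  In dimension one the
   basis is empty and the measure is the unit point mass at s \<omega>. *)
definition surface_measure :: "real ^ 'n \<Rightarrow> real \<Rightarrow> (real ^ 'n) measure" where
  "surface_measure \<omega> s =
     distr (\<Pi>\<^sub>M b\<in>hyperplane_basis \<omega>. (lborel :: real measure)) borel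
       (\<lambda>u. s *\<^sub>R \<omega> + (\<Sum>b\<in>hyperplane_basis \<omega>. u b *\<^sub>R b))"

(* Meaningful for \<omega> in the unit sphere. *)
definition radon :: "(real ^ 'n \<Rightarrow> complex) \<Rightarrow> (real ^ 'n) \<times> real \<Rightarrow> complex" where
  "radon g = (\<lambda>(\<omega>, s). LINT t:hyperplane \<omega> s|surface_measure \<omega> s. g t)"

end

theory Submission
  imports Defs
begin

text \<open>The data determine \<open>f\<close> itself. For \<open>\<omega>\<close> in the positive orthant and \<open>s \<le> 0\<close> the
  hyperplane \<open>H(\<omega>, s)\<close> misses the orthant, so the Radon transform vanishes there. Integrating
  \<open>exp (- r s)\<close> against the data over \<open>s > 0\<close> and using Fubini along \<open>\<omega>\<close> yields the Laplace
  transform of \<open>f\<close> at \<open>r \<omega>\<close>, hence on the whole orthant. The exponentials \<open>exp (- a \<bullet> t)\<close>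
  with \<open>a \<ge> 0\<close> span an algebra separating points, so by Stone-Weierstrass
  the Laplace transform of a compactly supported continuous function determines the function.\<close>

section \<open>Lebesgue measure in orthonormal coordinates\<close>

text \<open>Comparing \<open>M\<close> with Lebesgue measure through the double integral of
  \<open>1\<^sub>A(x) 1\<^sub>C(y)\<close> for the unit ball \<open>C = - C\<close> gives
  \<open>M(A) |C| = |A| M(C)\<close>. The library states rotation invariance of Lebesgue measure
  only for index types of class \<open>wellorder\<close>; this argument avoids that restriction.\<close>

lemma translation_invariant_measure_eq_lborel:
  fixes M :: "'a::euclidean_space measure"
  assumes sets: "sets M = sets borel"
    and translation: "\<And>a. distr M borel ((+) a) = M"
    and ball: "\<And>r. r > 0 \<Longrightarrow> emeasure M (cball 0 r) = emeasure lborel (cball (0::'a) r)"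
  shows "M = lborel"
proof (rule measure_eqI)
  show "sets M = sets lborel"
    using sets by simp
  note [measurable_cong] = sets
  have space: "space M = UNIV"
    using sets_eq_imp_space_eq[OF sets] by simp
  interpret M: sigma_finite_measure M
  proof
    \<comment> \<open>The radii are \<open>Suc n\<close> rather than \<open>n\<close> because
      \<open>ball\<close> speaks of positive radii only.\<close>
    have "(\<Union>n::nat. cball (0::'a) (real (Suc n))) = UNIV"
      by (auto simp: le_nat_floor) (metis of_nat_Suc real_arch_simple add.commute le_add_same_cancel1 order_trans zero_le_one)
    then show "\<exists>A. countable A \<and> A \<subseteq> sets M \<and> \<Union> A = space M \<and> (\<forall>a\<in>A. emeasure M a \<noteq> \<infinity>)"
      by (intro exI[of _ "range (\<lambda>n::nat. cball (0::'a) (real (Suc n)))"])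
        (auto simp: sets space ball emeasure_cball)
  qed
  interpret pair_sigma_finite M "lborel :: 'a measure" ..
  have shift_M: "(\<integral>\<^sup>+ x. F x \<partial>M) = (\<integral>\<^sup>+ x. F (a + x) \<partial>M)"
    if [measurable]: "F \<in> borel_measurable borel" for F a
    by (subst translation[of a, symmetric]) (simp add: nn_integral_distr)
  have shift_L: "(\<integral>\<^sup>+ x. F x \<partial>lborel) = (\<integral>\<^sup>+ x. F (a + x) \<partial>lborel)"
    if [measurable]: "F \<in> borel_measurable borel" for F and a :: 'a
    by (subst lborel_distr_plus[of a, symmetric]) (simp add: nn_integral_distr)
  fix A assume "A \<in> sets M"
  then have [measurable]: "A \<in> sets borel"
    by (simp add: sets)
  define C where "C = cball (0::'a) 1"
  have [measurable]: "C \<in> sets borel"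
    by (simp add: C_def)
  have symmetric: "indicator C (x - y) = (indicator C (y - x) :: ennreal)" for x y
    by (simp add: C_def indicator_def norm_minus_commute)
  have "emeasure M A * emeasure lborel C = (\<integral>\<^sup>+ x. indicator A x * emeasure lborel C \<partial>M)"
    by (simp add: nn_integral_multc sets)
  \<comment> \<open>Invariance of Lebesgue measure lets the translate \<open>x + C\<close> stand for
    \<open>C\<close>, which turns the product into a double integral.\<close>
  also have "\<dots> = (\<integral>\<^sup>+ x. indicator A x * (\<integral>\<^sup>+ y. indicator C (y - x) \<partial>lborel) \<partial>M)"
  proof (rule nn_integral_cong)
    fix x
    show "indicator A x * emeasure lborel C = indicator A x * (\<integral>\<^sup>+ y. indicator C (y - x) \<partial>lborel)"
      using shift_L[of "\<lambda>y. indicator C (y - x)" x] by simp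
  qed
  also have "\<dots> = (\<integral>\<^sup>+ x. (\<integral>\<^sup>+ y. indicator A x * indicator C (y - x) \<partial>lborel) \<partial>M)"
    by (simp add: nn_integral_cmult)
  also have "\<dots> = (\<integral>\<^sup>+ y. (\<integral>\<^sup>+ x. indicator A x * indicator C (x - y) \<partial>M) \<partial>lborel)"
    by (subst Fubini') (auto simp: symmetric)
  \<comment> \<open>Now \<open>M\<close> is shifted by \<open>y\<close>; after another exchange,
    shifting Lebesgue measure by \<open>x\<close> separates \<open>A\<close> from \<open>C\<close>,
    with the two measures interchanged.\<close>
  also have "\<dots> = (\<integral>\<^sup>+ y. (\<integral>\<^sup>+ x. indicator A (y + x) * indicator C x \<partial>M) \<partial>lborel)"
  proof (rule nn_integral_cong)
    fix y
    show "(\<integral>\<^sup>+ x. indicator A x * indicator C (x - y) \<partial>M)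
        = (\<integral>\<^sup>+ x. indicator A (y + x) * indicator C x \<partial>M)"
      using shift_M[of "\<lambda>x. indicator A x * indicator C (x - y)" y] by simp
  qed
  also have "\<dots> = (\<integral>\<^sup>+ x. (\<integral>\<^sup>+ y. indicator A (x + y) * indicator C x \<partial>lborel) \<partial>M)"
    by (subst Fubini') (auto simp: add.commute)
  also have "\<dots> = (\<integral>\<^sup>+ x. (\<integral>\<^sup>+ y. indicator A (x + y) \<partial>lborel) * indicator C x \<partial>M)"
    by (simp add: nn_integral_multc)
  also have "\<dots> = (\<integral>\<^sup>+ x. emeasure lborel A * indicator C x \<partial>M)"
    by (simp flip: shift_L)
  also have "\<dots> = emeasure lborel A * emeasure lborel C"
    using ball[of 1, folded C_def] by (simp add: nn_integral_cmult_indicator sets)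
  finally have "emeasure lborel C * emeasure M A = emeasure lborel C * emeasure lborel A"
    by (simp add: mult.commute)
  moreover have "unit_ball_vol (real DIM('a)) \<noteq> 0"
    using unit_ball_vol_pos[of "real DIM('a)"] by linarith
  then have "emeasure lborel C \<noteq> 0" "emeasure lborel C \<noteq> \<infinity>"
    by (simp_all add: C_def emeasure_cball)
  ultimately show "emeasure M A = emeasure lborel A"
    by (simp add: ennreal_mult_cancel_left)
qed

text \<open>Each side of a box is pulled back to a translate of equal length, and values on boxes
  determine a product measure. The restriction to \<open>I\<close> keeps the translate in the space
  of that measure.\<close>

lemma PiM_lborel_translate:
  fixes a :: "'i \<Rightarrow> real"
  assumes "finite I"
  shows "distr (\<Pi>\<^sub>M i\<in>I. lborel) (\<Pi>\<^sub>M i\<in>I. lborel) (\<lambda>u. \<lambda>i\<in>I. a i + u i) = (\<Pi>\<^sub>M i\<in>I. lborel)"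
proof -
  interpret product_sigma_finite "\<lambda>_::'i. lborel :: real measure" by standard
  show ?thesis
  proof (rule PiM_eqI[OF assms])
    fix A :: "'i \<Rightarrow> real set"
    assume A: "\<And>i. i \<in> I \<Longrightarrow> A i \<in> sets lborel"
    have "(\<lambda>u. \<lambda>i\<in>I. a i + u i) -` Pi\<^sub>E I A \<inter> space (\<Pi>\<^sub>M i\<in>I. lborel) = (\<Pi>\<^sub>E i\<in>I. (+) (a i) -` A i)"
      by (auto simp: space_PiM PiE_iff extensional_def)
    moreover have meas: "(+) (a i) -` A i \<in> sets borel" if "i \<in> I" for i
      using A[OF that] measurable_sets_borel[of "(+) (a i)" borel "A i"] by simp
    moreover have "emeasure lborel ((+) (a i) -` A i) = emeasure lborel (A i)" if "i \<in> I" for i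
      using A[OF that] by (subst (2) lborel_distr_plus[of "a i", symmetric]) (simp add: emeasure_distr)
    ultimately show "emeasure (distr (\<Pi>\<^sub>M i\<in>I. lborel) (\<Pi>\<^sub>M i\<in>I. lborel) (\<lambda>u. \<lambda>i\<in>I. a i + u i))
        (Pi\<^sub>E I A) = (\<Prod>i\<in>I. emeasure lborel (A i))"
      using A assms
      by (subst emeasure_distr) (auto simp: emeasure_PiM sets_PiM_I_finite intro!: prod.cong)
  qed simp
qed

text \<open>This is rotation invariance in coordinates: passing from coordinates to vectors is a
  linear isometry, so the image measure is translation invariant and gives balls their usual volume,
  which characterises Lebesgue measure.\<close>

lemma lborel_eq_distr_orthonormal_basis:
  fixes B :: "'a::euclidean_space set"
  assumes "orthonormal_basis_of UNIV B"
  shows "distr (\<Pi>\<^sub>M b\<in>B. lborel) borel (\<lambda>u. \<Sum>b\<in>B. u b *\<^sub>R b) = lborel"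
proof (rule translation_invariant_measure_eq_lborel)
  have B: "pairwise orthogonal B" "\<And>b. b \<in> B \<Longrightarrow> norm b = 1" "span B = UNIV" and fin: "finite B"
    using assms orthonormal_basis_of_finite by (auto simp: orthonormal_basis_of_def)
  \<comment> \<open>Unit vectors are nonzero, so orthogonality gives independence and
    \<open>B\<close> has \<open>DIM('a)\<close> elements; this matches the volume of the coordinate
    ball with that of \<open>cball 0 r\<close>.\<close>
  have "0 \<notin> B"
    using B(2) by force
  then have "independent B"
    using B(1) pairwise_orthogonal_independent by blast
  then have card: "card B = DIM('a)"
    using dim_span_eq_card_independent[of B] B(3) by simp
  let ?P = "\<Pi>\<^sub>M b\<in>B. (lborel :: real measure)" and ?F = "\<lambda>u. \<Sum>b\<in>B. u b *\<^sub>R b"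
  have norm: "norm (?F u) = sqrt (\<Sum>b\<in>B. (u b)\<^sup>2)" for u
  proof -
    have "pairwise (\<lambda>i j. orthogonal (u i *\<^sub>R i) (u j *\<^sub>R j)) B"
      using B(1) by (auto simp: pairwise_def orthogonal_clauses)
    then have "(norm (?F u))\<^sup>2 = (\<Sum>b\<in>B. (u b)\<^sup>2)"
      using fin by (simp add: norm_sum_Pythagorean B(2))
    then show ?thesis
      by (metis norm_ge_zero real_sqrt_unique)
  qed
  show "emeasure (distr ?P borel ?F) (cball 0 r) = emeasure lborel (cball (0::'a) r)" if "r > 0" for r
  proof -
    have "?F -` cball 0 r = {u. sqrt (\<Sum>b\<in>B. (u b)\<^sup>2) \<le> r}"
      by (auto simp: norm)
    then show ?thesis
      using that by (simp add: emeasure_distr emeasure_cball_aux fin card emeasure_cball)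
  qed
  show "distr (distr ?P borel ?F) borel ((+) a) = distr ?P borel ?F" for a
  proof -
    \<comment> \<open>Translation by \<open>a\<close> shifts each coordinate by
      \<open>a \<bullet> b\<close>, the coefficient of \<open>a\<close> in the orthonormal
      basis.\<close>
    let ?t = "\<lambda>u. \<lambda>b\<in>B. a \<bullet> b + u b"
    have "distr ?P borel ?F = distr (distr ?P ?P ?t) borel ?F"
      by (simp add: PiM_lborel_translate fin)
    also have "\<dots> = distr ?P borel (\<lambda>u. ?F (?t u))"
      by (subst distr_distr) (auto simp: o_def)
    also have "(\<lambda>u. ?F (?t u)) = (\<lambda>u. a + ?F u)"
      using orthonormal_basis_expand[OF B(1,2), of a] fin B(3)
      by (simp add: scaleR_add_left sum.distrib)
    finally show ?thesis
      by (subst distr_distr) (simp_all add: o_def)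
  qed
qed simp


section \<open>Fubini along a unit direction\<close>

text \<open>Adjoining \<open>\<omega>\<close> to the basis of its orthogonal complement gives
  orthonormal coordinates of the whole space; integrating out all but the coordinate along
  \<open>\<omega>\<close> leaves the Radon transform.\<close>

lemma integral_lborel_eq_integral_radon:
  fixes g :: "real ^ 'n \<Rightarrow> complex"
  assumes g: "integrable lborel g" and \<omega>: "norm \<omega> = 1"
  shows "integral\<^sup>L lborel g = (LINT s|lborel. radon g (\<omega>, s))"
proof -
  let ?B = "hyperplane_basis \<omega>"
  have B: "pairwise orthogonal ?B" "\<And>b. b \<in> ?B \<Longrightarrow> norm b = 1" "span ?B = hyperplane \<omega> 0"
    and fin: "finite ?B"
    using hyperplane_basis[of \<omega>] orthonormal_basis_of_finite by (auto simp: orthonormal_basis_of_def)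
  have perp: "\<omega> \<bullet> b = 0" if "b \<in> ?B" for b
    using span_base[OF that] B(3) by (auto simp: hyperplane_def)
  have unit: "\<omega> \<bullet> \<omega> = 1"
    using \<omega> by (simp add: norm_eq_1)
  have notin: "\<omega> \<notin> ?B"
    using perp unit by force
  \<comment> \<open>Removing the component along \<open>\<omega>\<close> leaves a vector of the
    orthogonal complement, which \<open>?B\<close> spans.\<close>
  have "x \<in> span (insert \<omega> ?B)" for x
  proof -
    have "x - (\<omega> \<bullet> x) *\<^sub>R \<omega> \<in> span ?B"
      by (simp add: B(3) hyperplane_def inner_diff_right unit)
    then show ?thesis
      by (auto simp: span_insert)
  qed
  then have basis: "orthonormal_basis_of UNIV (insert \<omega> ?B)"
    using B(1,2) \<omega> perp
    by (auto simp: orthonormal_basis_of_def pairwise_insert orthogonal_def inner_commute)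
  interpret product_sigma_finite "\<lambda>_::real ^ 'n. lborel :: real measure" by standard
  let ?P = "\<lambda>I. \<Pi>\<^sub>M b\<in>I. (lborel :: real measure)"
  let ?F = "\<lambda>u. \<Sum>b\<in>insert \<omega> ?B. u b *\<^sub>R b"
  interpret PB: sigma_finite_measure "?P ?B"
    by (rule sigma_finite) (fact fin)
  have [measurable]: "g \<in> borel_measurable borel"
    using g by auto
  define G where "G s = (\<integral>u. g (s *\<^sub>R \<omega> + (\<Sum>b\<in>?B. u b *\<^sub>R b)) \<partial>?P ?B)" for s
  have "G \<in> borel_measurable lborel"
    unfolding G_def by measurable
  have radon: "radon g (\<omega>, s) = G s" for s
  proof -
    \<comment> \<open>The parametrisation lands in the hyperplane, so the indicator in the set
      integral is constantly 1 along it.\<close>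
    have "\<omega> \<bullet> (s *\<^sub>R \<omega> + (\<Sum>b\<in>?B. u b *\<^sub>R b)) = s" for u
      by (simp add: inner_add_right inner_sum_right perp unit)
    moreover have [measurable]: "hyperplane \<omega> s \<in> sets borel"
      unfolding hyperplane_def by (intro borel_closed closed_hyperplane)
    ultimately show ?thesis
      unfolding radon_def surface_measure_def set_lebesgue_integral_def G_def
      by (simp add: integral_distr hyperplane_def)
  qed
  have int: "integrable (?P (insert \<omega> ?B)) (\<lambda>u. g (?F u))"
    using g by (subst (asm) lborel_eq_distr_orthonormal_basis[OF basis, symmetric])
      (simp add: integrable_distr_eq)
  have "integral\<^sup>L lborel g = (\<integral>u. g (?F u) \<partial>?P ({\<omega>} \<union> ?B))"
    by (subst lborel_eq_distr_orthonormal_basis[OF basis, symmetric]) (simp add: integral_distr)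
  also have "\<dots> = (\<integral>v. (\<integral>u. g (?F (merge {\<omega>} ?B (v, u))) \<partial>?P ?B) \<partial>?P {\<omega>})"
    using notin fin int by (intro product_integral_fold) auto
  also have "\<dots> = (\<integral>v. G (v \<omega>) \<partial>?P {\<omega>})"
  proof -
    have "?F (merge {\<omega>} ?B (v, u)) = v \<omega> *\<^sub>R \<omega> + (\<Sum>b\<in>?B. u b *\<^sub>R b)" for u v
    proof -
      have "(\<Sum>b\<in>?B. merge {\<omega>} ?B (v, u) b *\<^sub>R b) = (\<Sum>b\<in>?B. u b *\<^sub>R b)"
        using notin by (intro sum.cong) (auto simp: merge_def)
      then show ?thesis
        using notin fin by (simp add: merge_def)
    qed
    then show ?thesis
      by (simp add: G_def)
  qed
  also have "\<dots> = integral\<^sup>L lborel G"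
    by (rule product_integral_singleton) fact
  finally show ?thesis
    by (simp add: radon)
qed


section \<open>Injectivity of the Laplace transform\<close>

lemma integrable_lborel_compact_support:
  fixes f :: "'a::euclidean_space \<Rightarrow> 'b::{banach, second_countable_topology}"
  assumes "continuous_on UNIV f" "compact K" "\<And>x. x \<notin> K \<Longrightarrow> f x = 0"
  shows "integrable lborel f"
proof -
  have "integrable lborel (\<lambda>x. indicator K x *\<^sub>R f x)"
    using assms by (intro borel_integrable_compact) (auto intro: continuous_on_subset)
  also have "(\<lambda>x. indicator K x *\<^sub>R f x) = f"
    using assms(3) by (auto simp: indicator_def)
  finally show ?thesis .
qed

text \<open>A zero integral forces \<open>f\<close> to vanish off a null set; by continuity the
  exceptional set is open, and a nonempty open set is not negligible.\<close>

lemma continuous_integral_zero_imp_zero: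
  fixes f :: "'a::euclidean_space \<Rightarrow> real"
  assumes "continuous_on UNIV f" "integrable lborel f" "\<And>x. f x \<ge> 0" "integral\<^sup>L lborel f \<le> 0"
  shows "f x = 0"
proof -
  have "integral\<^sup>L lborel f = 0"
    using assms(3,4) by (simp add: antisym)
  then have "AE x in lborel. f x = 0"
    using assms(2,3) by (simp add: integral_nonneg_eq_0_iff_AE)
  then have "AE x in lebesgue. x \<notin> {x. f x \<noteq> 0}"
    using AE_completion by force
  then have "negligible {x. f x \<noteq> 0}"
    by (simp add: negligible_iff_null_sets AE_iff_null_sets completion.AE_iff_null_sets)
  moreover have "open {x. f x \<noteq> 0}"
    using assms(1) by (intro open_Collect_neq) auto
  ultimately show ?thesis
    using open_not_negligible by blast
qed

text \<open>\<open>h\<close> is approximated uniformly on \<open>K\<close> by functions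
  \<open>g\<close> for which \<open>g * h\<close> has zero weighted integral. Hence the weighted
  integral of \<open>h * h\<close> is arbitrarily small, and \<open>h\<close> vanishes.\<close>

lemma laplace_transform_injective:
  fixes h :: "real ^ 'n \<Rightarrow> real"
  assumes h: "continuous_on UNIV h" and K: "compact K" "\<And>t. t \<notin> K \<Longrightarrow> h t = 0"
    and zero: "\<And>x. x \<in> pos_orthant \<Longrightarrow> (\<integral>t. exp (- (x \<bullet> t)) * h t \<partial>lborel) = 0"
  shows "h t = 0"
proof -
  have int: "integrable lborel (\<lambda>t. u t * h t)" if "continuous_on UNIV u" for u
    using that h K by (intro integrable_lborel_compact_support[of _ K] continuous_intros) auto
  txt \<open>The multipliers \<open>P\<close> of the space \<open>V\<close> form an algebra, which contains the
    exponentials; since \<open>1 \<in> V\<close>, it is contained in \<open>V\<close>.\<close>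
  define V where "V = {u. continuous_on UNIV u \<and>
    (\<forall>x\<in>pos_orthant. (\<integral>t. exp (- (x \<bullet> t)) * u t * h t \<partial>lborel) = 0)}"
  define P where "P g \<longleftrightarrow> continuous_on UNIV g \<and> (\<forall>u\<in>V. (\<lambda>t. g t * u t) \<in> V)"
    for g :: "real ^ 'n \<Rightarrow> real"
  have V_add: "(\<lambda>t. u t + v t) \<in> V" if "u \<in> V" "v \<in> V" for u v
  proof -
    have cont: "continuous_on UNIV u" "continuous_on UNIV v"
      using that by (auto simp: V_def)
    have "integrable lborel (\<lambda>t. exp (- (x \<bullet> t)) * u t * h t)"
      "integrable lborel (\<lambda>t. exp (- (x \<bullet> t)) * v t * h t)" for x
      by (intro int continuous_intros cont)+
    then show ?thesis
      using that by (auto simp: V_def algebra_simps intro!: continuous_intros)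
  qed
  have P_const: "P (\<lambda>_. c)" for c
    by (auto simp: P_def V_def mult.left_commute[of _ c] mult.assoc intro!: continuous_intros)
  have P_exp: "P (\<lambda>t. exp (- (a \<bullet> t)))" if a: "\<And>i. 0 \<le> a $ i" for a
    unfolding P_def
  proof (intro conjI ballI)
    fix u assume u: "u \<in> V"
    show "(\<lambda>t. exp (- (a \<bullet> t)) * u t) \<in> V"
      unfolding V_def
    proof (intro CollectI conjI ballI)
      show "continuous_on UNIV (\<lambda>t. exp (- (a \<bullet> t)) * u t)"
        using u by (auto simp: V_def intro!: continuous_intros)
      fix x :: "real ^ 'n" assume "x \<in> pos_orthant"
      \<comment> \<open>The new factor shifts the Laplace variable from \<open>x\<close> to
        \<open>x + a\<close>, and the open orthant absorbs nonnegative shifts. Boundary vectors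
        \<open>a\<close> are included because coordinate axes serve to separate points.\<close>
      then have "x + a \<in> pos_orthant"
        using a by (auto simp: pos_orthant_def intro: add_pos_nonneg)
      then have "(\<integral>t. exp (- ((x + a) \<bullet> t)) * u t * h t \<partial>lborel) = 0"
        using u by (auto simp: V_def)
      then show "(\<integral>t. exp (- (x \<bullet> t)) * (exp (- (a \<bullet> t)) * u t) * h t \<partial>lborel) = 0"
        by (simp add: inner_add_left exp_diff exp_minus field_simps exp_add)
    qed
  qed (auto intro!: continuous_intros)
  have one: "(\<lambda>_. 1) \<in> V"
    using zero by (auto simp: V_def)
  \<comment> \<open>The origin lies outside the open orthant, so the unweighted integral is not
    directly available; the all-ones vector lies inside and supplies a strictly positive
    weight.\<close>
  define e where "e t = exp (- ((1::real ^ 'n) \<bullet> t))" for t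
  have e: "continuous_on UNIV e"
    unfolding e_def by (intro continuous_intros)
  let ?c = "\<integral>t. e t * \<bar>h t\<bar> \<partial>lborel"
  have int_abs: "integrable lborel (\<lambda>t. e t * \<bar>h t\<bar>)"
    using h e K by (intro integrable_lborel_compact_support[of _ K] continuous_intros) auto
  have int_sq: "integrable lborel (\<lambda>t. e t * h t * h t)"
    using h e by (intro int continuous_intros)
  have "(\<integral>t. e t * h t * h t \<partial>lborel) \<le> \<epsilon> * ?c" if "\<epsilon> > 0" for \<epsilon>
  proof -
    have "\<exists>g. P g \<and> (\<forall>t\<in>K. \<bar>h t - g t\<bar> < \<epsilon>)"
    proof (rule Stone_Weierstrass_HOL[OF K(1)])
      show "\<exists>g. P g \<and> g s \<noteq> g t" if st: "s \<in> K \<and> t \<in> K \<and> s \<noteq> t" for s t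
      proof -
        obtain i where "s $ i \<noteq> t $ i"
          using st by (auto simp: vec_eq_iff)
        moreover have "P (\<lambda>t. exp (- (axis i 1 \<bullet> t)))"
          by (rule P_exp) (simp add: axis_def)
        ultimately show ?thesis
          by (intro exI[of _ "\<lambda>t. exp (- (axis i 1 \<bullet> t))"]) (simp add: inner_axis')
      qed
      show "P (\<lambda>t. f t + g t)" if "P f \<and> P g" for f g
        using that V_add by (auto simp: P_def distrib_right intro!: continuous_intros)
      show "P (\<lambda>t. f t * g t)" if "P f \<and> P g" for f g
        using that by (auto simp: P_def mult.assoc intro!: continuous_intros)
      show "continuous_on K f" if "P f" for f
        using that by (auto simp: P_def intro: continuous_on_subset)
      show "continuous_on K h"
        using h by (rule continuous_on_subset) simp
    qed (use P_const that in auto)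
    then obtain g where g: "P g" "\<And>t. t \<in> K \<Longrightarrow> \<bar>h t - g t\<bar> < \<epsilon>"
      by blast
    have g_cont: "continuous_on UNIV g"
      using g(1) by (simp add: P_def)
    have "g \<in> V"
      using g(1) one by (auto simp: P_def dest!: bspec)
    moreover have "(1::real ^ 'n) \<in> pos_orthant"
      by (simp add: pos_orthant_def)
    ultimately have "(\<integral>t. e t * g t * h t \<partial>lborel) = 0"
      by (auto simp: V_def e_def)
    moreover have "integrable lborel (\<lambda>t. e t * g t * h t)"
      using g_cont e by (intro int continuous_intros)
    \<comment> \<open>The term with \<open>g\<close> integrates to zero and is subtracted; what
      remains is \<open>e * (h - g) * h\<close>, controlled by the approximation on \<open>K\<close>
      and zero off \<open>K\<close>.\<close>
    ultimately have "(\<integral>t. e t * h t * h t \<partial>lborel) = (\<integral>t. e t * h t * h t - e t * g t * h t \<partial>lborel)"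
      using int_sq by simp
    also have "\<dots> \<le> (\<integral>t. \<epsilon> * (e t * \<bar>h t\<bar>) \<partial>lborel)"
    proof (rule integral_mono)
      show "e t * h t * h t - e t * g t * h t \<le> \<epsilon> * (e t * \<bar>h t\<bar>)" for t
      proof (cases "t \<in> K")
        case True
        have "e t * h t * h t - e t * g t * h t = e t * ((h t - g t) * h t)"
          by (simp add: algebra_simps)
        also have "(h t - g t) * h t \<le> \<bar>h t - g t\<bar> * \<bar>h t\<bar>"
          by (metis abs_ge_self abs_mult)
        also have "\<dots> \<le> \<epsilon> * \<bar>h t\<bar>"
          using g(2)[OF True] by (intro mult_right_mono) auto
        finally show ?thesis
          by (simp add: e_def mult.left_commute)
      qed (simp add: K)
    qed (use int_abs int_sq \<open>integrable lborel (\<lambda>t. e t * g t * h t)\<close> in auto)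
    finally show ?thesis
      by simp
  qed
  \<comment> \<open>\<open>?c\<close> depends on neither \<open>\<epsilon>\<close> nor the
    approximant, so \<open>\<epsilon>\<close> may tend to 0 from the right.\<close>
  then have "(\<integral>t. e t * h t * h t \<partial>lborel) \<le> 0"
    by (intro tendsto_lowerbound[of "\<lambda>\<epsilon>. \<epsilon> * ?c" 0 "at_right 0"])
      (auto intro!: tendsto_eq_intros simp: eventually_at_right_less eventually_at_filter)
  then have "e t * h t * h t = 0"
    using int_sq h e
    by (intro continuous_integral_zero_imp_zero[of "\<lambda>t. e t * h t * h t"] continuous_intros)
      (auto simp: e_def mult.assoc)
  then show ?thesis
    by (simp add: e_def)
qed


section \<open>From Radon data to the Laplace transform\<close>

text \<open>On the hyperplane \<open>\<omega> \<bullet> t\<close> has the value \<open>s\<close>, so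
  the factor is constant there.\<close>

lemma radon_mult_of_inner:
  "radon (\<lambda>t. \<phi> (\<omega> \<bullet> t) *\<^sub>R f t) (\<omega>, s) = \<phi> s *\<^sub>R radon f (\<omega>, s)"
proof -
  have "indicat_real (hyperplane \<omega> s) t *\<^sub>R \<phi> (\<omega> \<bullet> t) *\<^sub>R f t =
      \<phi> s *\<^sub>R (indicat_real (hyperplane \<omega> s) t *\<^sub>R f t)" for t
    by (auto simp: indicator_def hyperplane_def)
  then show ?thesis
    by (simp only: radon_def set_lebesgue_integral_def prod.case integral_scaleR_right)
qed

text \<open>Positive vectors have positive inner product, so these hyperplanes miss the orthant.
  This is why data on the half-line \<open>s > 0\<close> suffice.\<close>

lemma radon_nonpos_eq_0:
  assumes f: "\<And>t. t \<notin> pos_orthant \<Longrightarrow> f t = 0" and "\<omega> \<in> pos_orthant" "s \<le> 0"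
  shows "radon f (\<omega>, s) = 0"
proof -
  have "f t = 0" if "t \<in> hyperplane \<omega> s" for t
  proof (rule f, rule notI)
    assume "t \<in> pos_orthant"
    then have "\<omega> \<bullet> t > 0"
      using assms(2) by (auto simp: inner_vec_def pos_orthant_def intro!: sum_pos)
    then show False
      using that assms(3) by (simp add: hyperplane_def)
  qed
  then have "indicat_real (hyperplane \<omega> s) t *\<^sub>R f t = 0" for t
    by (auto simp: indicator_def)
  then show ?thesis
    by (simp only: radon_def set_lebesgue_integral_def prod.case integral_zero)
qed

lemma open_pos_orthant: "open (pos_orthant :: (real ^ 'n) set)"
proof -
  have "pos_orthant = (\<Inter>i. {x :: real ^ 'n. 0 < x $ i})"
    by (auto simp: pos_orthant_def)
  moreover have "open (\<Inter>i. {x :: real ^ 'n. 0 < x $ i})"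
    by (intro open_INT ballI finite open_Collect_less continuous_intros)
  ultimately show ?thesis
    by (rule ssubst)
qed

lemma test_function_support:
  assumes "f \<in> test_functions"
  shows "\<exists>K. compact K \<and> K \<subseteq> pos_orthant \<and> (\<forall>t. t \<notin> K \<longrightarrow> f t = 0)"
proof (intro exI conjI allI impI)
  show "compact (closure {x. f x \<noteq> 0})" "closure {x. f x \<noteq> 0} \<subseteq> pos_orthant"
    using assms by (simp_all add: test_functions_def)
  show "f t = 0" if "t \<notin> closure {x. f x \<noteq> 0}" for t
    using that closure_subset[of "{x. f x \<noteq> 0}"] by blast
qed

lemma test_function_eq_0:
  assumes "f \<in> test_functions" "t \<notin> pos_orthant"
  shows "f t = 0"
proof -
  obtain K where "K \<subseteq> pos_orthant" "\<And>t. t \<notin> K \<Longrightarrow> f t = 0"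
    using test_function_support[OF assms(1)] by blast
  then show ?thesis
    using assms(2) by blast
qed

text \<open>Smoothness is given on the orthant only; on the complement of the compact support the
  function is zero. These two open sets cover the space, and continuity glues.\<close>

lemma test_function_continuous:
  assumes "f \<in> test_functions"
  shows "continuous_on UNIV f"
proof -
  obtain K where K: "compact K" "K \<subseteq> pos_orthant" "\<And>t. t \<notin> K \<Longrightarrow> f t = 0"
    using test_function_support[OF assms] by blast
  have "cont_diff_on 0 pos_orthant f"
    using assms unfolding test_functions_def smooth_on_def by blast
  moreover have "continuous_on (- K) f \<longleftrightarrow> continuous_on (- K) (\<lambda>_. 0 :: complex)"
    using K(3) by (intro continuous_on_cong) auto
  ultimately have "continuous_on (pos_orthant \<union> - K) f"
    using compact_imp_closed[OF K(1)] by (intro continuous_on_open_Un open_pos_orthant) auto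
  moreover have "pos_orthant \<union> - K = UNIV"
    using K(2) by auto
  ultimately show ?thesis
    by simp
qed

text \<open>As \<open>x\<close> is \<open>norm x\<close> times a unit vector, the exponential is
  constant on each hyperplane orthogonal to \<open>x\<close> and leaves the Radon transform as a
  factor.\<close>

lemma laplace_transform_eq_integral_radon:
  assumes f: "f \<in> test_functions" and x: "x \<in> pos_orthant"
  shows "(\<integral>t. exp (- (x \<bullet> t)) *\<^sub>R f t \<partial>lborel) =
    (LINT s|lborel. indicator {0<..} s *\<^sub>R exp (- (norm x * s)) *\<^sub>R radon f (x /\<^sub>R norm x, s))"
proof -
  let ?\<omega> = "x /\<^sub>R norm x"
  have "x \<noteq> 0"
    using x by (auto simp: pos_orthant_def)
  then have \<omega>: "norm ?\<omega> = 1" and inner: "x \<bullet> t = norm x * (?\<omega> \<bullet> t)" for t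
    by simp_all
  have pos: "?\<omega> \<in> pos_orthant"
    using x \<open>x \<noteq> 0\<close> by (simp add: pos_orthant_def)
  obtain K where "compact K" "\<And>t. t \<notin> K \<Longrightarrow> f t = 0"
    using test_function_support[OF f] by blast
  then have "integrable lborel (\<lambda>t. exp (- (x \<bullet> t)) *\<^sub>R f t)"
    using test_function_continuous[OF f]
    by (intro integrable_lborel_compact_support[of _ K] continuous_intros) auto
  then have "(\<integral>t. exp (- (x \<bullet> t)) *\<^sub>R f t \<partial>lborel) =
      (LINT s|lborel. radon (\<lambda>t. exp (- (x \<bullet> t)) *\<^sub>R f t) (?\<omega>, s))"
    using \<omega> by (rule integral_lborel_eq_integral_radon)
  also have "\<dots> = (LINT s|lborel. exp (- (norm x * s)) *\<^sub>R radon f (?\<omega>, s))"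
    unfolding inner by (subst radon_mult_of_inner[of "\<lambda>s. exp (- (norm x * s))"]) (rule refl)
  also have "\<dots> = (LINT s|lborel. indicator {0<..} s *\<^sub>R exp (- (norm x * s)) *\<^sub>R radon f (?\<omega>, s))"
  proof (intro Bochner_Integration.integral_cong refl)
    fix s
    have "radon f (?\<omega>, s) = 0" if "s \<le> 0"
      using radon_nonpos_eq_0[OF _ pos that] test_function_eq_0[OF f] by blast
    then show "exp (- (norm x * s)) *\<^sub>R radon f (?\<omega>, s) =
        indicator {0<..} s *\<^sub>R exp (- (norm x * s)) *\<^sub>R radon f (?\<omega>, s)"
      by (cases "s \<le> 0") (simp_all add: indicator_def)
  qed
  finally show ?thesis .
qed

section \<open>Recovery from the incomplete data\<close>

text \<open>Each ray of the orthant meets \<open>pos_sphere\<close>, so equal data make the Laplace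
  transform of \<open>f - g\<close> vanish on the whole orthant.\<close>

lemma test_function_determined_by_radon:
  assumes f: "f \<in> test_functions" and g: "g \<in> test_functions"
    and eq: "restrict (radon f) (pos_sphere \<times> {0<..}) = restrict (radon g) (pos_sphere \<times> {0<..})"
  shows "f = g"
proof
  fix t
  obtain K\<^sub>f where K\<^sub>f: "compact K\<^sub>f" "\<And>t. t \<notin> K\<^sub>f \<Longrightarrow> f t = 0"
    using test_function_support[OF f] by blast
  obtain K\<^sub>g where K\<^sub>g: "compact K\<^sub>g" "\<And>t. t \<notin> K\<^sub>g \<Longrightarrow> g t = 0"
    using test_function_support[OF g] by blast
  define K where "K = K\<^sub>f \<union> K\<^sub>g"
  have K: "compact K"
    using K\<^sub>f(1) K\<^sub>g(1) by (simp add: K_def compact_Un)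
  have off: "f t = 0" "g t = 0" if "t \<notin> K" for t
    using K\<^sub>f(2) K\<^sub>g(2) that by (auto simp: K_def)
  note cont = test_function_continuous[OF f] test_function_continuous[OF g]
  have radon_eq: "radon f (\<omega>, s) = radon g (\<omega>, s)" if "\<omega> \<in> pos_sphere" "s > 0" for \<omega> s
    using fun_cong[OF eq, of "(\<omega>, s)"] that by simp
  have laplace: "(\<integral>t. exp (- (x \<bullet> t)) *\<^sub>R (f t - g t) \<partial>lborel) = 0" if x: "x \<in> pos_orthant" for x
  proof -
    have "x \<noteq> 0"
      using x by (auto simp: pos_orthant_def)
    then have "x /\<^sub>R norm x \<in> pos_sphere"
      using x by (auto simp: pos_sphere_def pos_orthant_def)
    then have "(\<integral>t. exp (- (x \<bullet> t)) *\<^sub>R f t \<partial>lborel) = (\<integral>t. exp (- (x \<bullet> t)) *\<^sub>R g t \<partial>lborel)"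
      unfolding laplace_transform_eq_integral_radon[OF f x] laplace_transform_eq_integral_radon[OF g x]
      by (intro Bochner_Integration.integral_cong refl) (auto simp: indicator_def radon_eq)
    moreover have "integrable lborel (\<lambda>t. exp (- (x \<bullet> t)) *\<^sub>R f t)"
      "integrable lborel (\<lambda>t. exp (- (x \<bullet> t)) *\<^sub>R g t)"
      using cont K off by (auto intro!: integrable_lborel_compact_support[of _ K] continuous_intros)
    ultimately show ?thesis
      by (simp add: scaleR_diff_right)
  qed
  have int: "integrable lborel (\<lambda>t. exp (- (x \<bullet> t)) *\<^sub>R (f t - g t))" for x
    using cont K off by (intro integrable_lborel_compact_support[of _ K] continuous_intros) auto
  \<comment> \<open>Injectivity of the Laplace transform is stated for real functions, hence the
    split into real and imaginary parts.\<close>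
  have "Re (f t - g t) = 0"
  proof (rule laplace_transform_injective[OF _ K])
    show "(\<integral>t. exp (- (x \<bullet> t)) * Re (f t - g t) \<partial>lborel) = 0" if "x \<in> pos_orthant" for x
      using arg_cong[OF laplace[OF that], of Re] int[of x] by (simp flip: integral_Re)
  qed (use cont off in \<open>auto intro!: continuous_intros\<close>)
  moreover have "Im (f t - g t) = 0"
  proof (rule laplace_transform_injective[OF _ K])
    show "(\<integral>t. exp (- (x \<bullet> t)) * Im (f t - g t) \<partial>lborel) = 0" if "x \<in> pos_orthant" for x
      using arg_cong[OF laplace[OF that], of Im] int[of x] by (simp flip: integral_Im)
  qed (use cont off in \<open>auto intro!: continuous_intros\<close>)
  ultimately show "f t = g t"
    by (simp add: complex_eq_iff)
qed

theorem theorem4p5: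
  shows "\<exists>\<Phi> :: ((real ^ 'n) \<times> real \<Rightarrow> complex) \<Rightarrow> ((real ^ 'n) \<times> real \<Rightarrow> complex).
           \<forall>f \<in> test_functions. \<forall>\<omega> \<in> sphere 0 1. \<forall>s :: real.
             radon f (\<omega>, s) = \<Phi> (restrict (radon f) (pos_sphere \<times> {0<..})) (\<omega>, s)"
proof -
  let ?data = "\<lambda>f :: real ^ 'n \<Rightarrow> complex. restrict (radon f) (pos_sphere \<times> {0<..})"
  \<comment> \<open>\<open>\<Phi>\<close> picks a test function with the given data and returns its
    full Radon transform; injectivity makes the pick unique. On functions that are not data of any
    test function its value is arbitrary.\<close>
  have "inj_on ?data test_functions"
    by (intro inj_onI test_function_determined_by_radon)
  from inv_into_f_f[OF this] show ?thesis
    by (intro exI[of _ "\<lambda>d. radon (inv_into test_functions ?data d)"]) simp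
qed

end
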